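(* Consider any instance of DCIC with $c_{\mathrm{Del}}=0$. Let $M^*$ be the mechanism that, if $\max_{i\in[n]}\mathbb E[X_i]\ge \frac12\mathbb E[\max_{i\in[n]}(X_i-c_i)^+]$, selects some $i^*\in\arg\max_{i\in[n]}\mathbb E[X_i]$ without delegating or inspecting anything, and otherwise runs the SPMI with threshold $\tau^*$. Then $M^*$ is $3$-approximate, i.e. $\mathbb E[\mathrm{Opt}]\le 3\,\mathbb E[M^*]$.
   Context: Delegated choice with inspection cost (DCIC). There are $n$ alternatives indexed by $[n]=\{1,\dots,n\}$. Each alternative $i$ has a principal's utility $X_i\ge 0$ and an agent's utility $Y_i\ge 0$; the pairs $(X_i,Y_i)$, $i\in[n]$, are mutually independent random vectors (with $X_i$ and $Y_i$ possibly dependent), $X_i\sim D^X_i$, $Y_i\sim D^Y_i$. The principal knows the distributions $D^X_i$ but not the $D^Y_i$. Alternative $i$ has a deterministic inspection cost $c_i\ge 0$; delegating costs the principal $c_{\mathrm{Del}}\ge 0$. An inspection policy is a deterministic adaptive procedure which at each step, based on the already inspected alternatives and their revealed values $X_j$ (and on the agent's signal, if any), either inspects a not-yet-inspected alternative $i$ (paying $c_i$ and learning $X_i$), or selects one alternative $i$ (inspected or not) and stops, or stops selecting nothing. A (deterministic) mechanism either does not delegate and runs an inspection policy, or delegates: it pays $c_{\mathrm{Del}}$, fixes a signal set $\Sigma$ and a map $\mathrm{Sig}$ from $\Sigma$ to inspection policies; the agent observes all realizations $(X_i,Y_i)_{i\in[n]}$ and sends a signal $\sigma\in\Sigma$ maximizing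 his utility ($Y_k$ if alternative $k$ is finally selected by $\mathrm{Sig}(\sigma)$, $0$ if none is selected), breaking ties in favor of the principal (among signals giving him equal utility he sends one maximizing the principal's realized utility); the principal then runs $\mathrm{Sig}(\sigma)$. With $\mathbf A_i,\mathbf I_i\in\{0,1\}$ indicating that $i$ is selected / inspected and $\mathbf I_{\mathrm{Del}}\in\{0,1\}$ indicating delegation, the principal's realized utility is $\sum_{i}(\mathbf A_iX_i-\mathbf I_ic_i)-\mathbf I_{\mathrm{Del}}c_{\mathrm{Del}}$. The value $\mathbb E[M]$ of a mechanism $M$ is the infimum, over all agent utility distributions $(D^Y_i)_i$ (with the independence structure above), of the principal's expected realized utility. $\mathrm{Opt}$ denotes an optimal mechanism and $\mathbb E[\mathrm{Opt}]$ the supremum of $\mathbb E[M]$ over all mechanisms $M$. A mechanism $M$ is $\beta$-approximate if $\beta\,\mathbb E[M]\ge \mathbb E[\mathrm{Opt}]$. $(z)^+=\max(z,0)$. The single-proposal mechanism with inspection (SPMI) with threshold $\tau$ is the delegating mechanism with $\Sigma=[n]\cup\{\perp\}$: on signal $j\in[n]$ the principal inspects $j$ and selects $j$ iff $X_j-c_j\ge\tau$ (otherwise selects nothing); on signal $\perp$ nothing is inspected or selected. $\tau^*$ denotes a threshold such that the SPMI with threshold $\tau^*$ guarantees, against every agent, principal's expected utility excluding the delegation cost of at least $\frac12\mathbb E[\max_{i\in[n]}(X_i-c_i)^+]$ (such a threshold exists). *)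

theory Defs
  imports "HOL-Probability.Probability"
begin

text \<open>Alternatives are indexed by 0..n-1 (i.e. the set lessThan n) instead of 1..n.
Realizations are functions nat to real (principal values) resp. nat to real times real
(pairs (X_i, Y_i)); only indices below n are relevant.\<close>

text \<open>Deterministic adaptive inspection policies as decision trees: inspect alternative i
and continue depending on the revealed value of X_i; select alternative i and stop;
stop without selecting anything.\<close>
datatype policy = Inspect nat "real \<Rightarrow> policy" | Select nat | Stop

primrec valid_policy :: "nat \<Rightarrow> nat set \<Rightarrow> policy \<Rightarrow> bool" where
  "valid_policy n S (Inspect i f) =
     (i < n \<and> i \<notin> S \<and> (\<forall>v. valid_policy n (insert i S) (f v)))"
| "valid_policy n S (Select i) = (i < n)"
| "valid_policy n S Stop = True"

primrec outcome :: "policy \<Rightarrow> (nat \<Rightarrow> real) \<Rightarrow> nat option \<times> nat list" where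
  "outcome (Inspect i f) = (\<lambda>x. let r = outcome (f (x i)) x in (fst r, i # snd r))"
| "outcome (Select i) = (\<lambda>x. (Some i, []))"
| "outcome Stop = (\<lambda>x. (None, []))"

definition principal_util :: "(nat \<Rightarrow> real) \<Rightarrow> policy \<Rightarrow> (nat \<Rightarrow> real) \<Rightarrow> real" where
  "principal_util c p x =
     (let r = outcome p x in
       (case fst r of None \<Rightarrow> 0 | Some k \<Rightarrow> x k) - sum_list (map c (snd r)))"

definition agent_util :: "policy \<Rightarrow> (nat \<Rightarrow> real) \<Rightarrow> (nat \<Rightarrow> real) \<Rightarrow> real" where
  "agent_util p x y = (case fst (outcome p x) of None \<Rightarrow> 0 | Some k \<Rightarrow> y k)"

datatype 'sig mechanism = NoDel policy | Del "'sig set" "'sig \<Rightarrow> policy"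

text \<open>Principal's realized utility for a realization w (w i = (X_i, Y_i)).  Under delegation
the agent sends a signal maximizing his utility, breaking ties in favour of the principal,
so the principal gets the largest principal utility among agent-optimal signals.\<close>
fun realized_util :: "real \<Rightarrow> (nat \<Rightarrow> real) \<Rightarrow> 'sig mechanism \<Rightarrow> (nat \<Rightarrow> real \<times> real) \<Rightarrow> real" where
  "realized_util cdel c (NoDel p) w = principal_util c p (\<lambda>i. fst (w i))"
| "realized_util cdel c (Del Sig_set Sig) w =
     Sup {principal_util c (Sig s) (\<lambda>i. fst (w i)) | s.
            s \<in> Sig_set \<and>
            (\<forall>s'\<in>Sig_set. agent_util (Sig s') (\<lambda>i. fst (w i)) (\<lambda>i. snd (w i))
                          \<le> agent_util (Sig s) (\<lambda>i. fst (w i)) (\<lambda>i. snd (w i)))}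
     - cdel"

text \<open>An agent (joint law of (X_i, Y_i) for each i, independence across i via the product
measure) is compatible with the principal's known distributions DX if the X-marginals are
DX i and the agent utilities are nonnegative.\<close>
definition agent_law :: "nat \<Rightarrow> (nat \<Rightarrow> real measure) \<Rightarrow> (nat \<Rightarrow> (real \<times> real) measure) \<Rightarrow> bool" where
  "agent_law n DX DXY \<longleftrightarrow>
     (\<forall>i<n. prob_space (DXY i) \<and> sets (DXY i) = sets borel \<and>
            distr (DXY i) borel fst = DX i \<and> (AE p in DXY i. 0 \<le> snd p))"

text \<open>Admissible mechanisms: well-formed policies, nonempty signal set, and a measurable
realized utility (so that the expectation is meaningful).\<close>
definition admissible :: "nat \<Rightarrow> (nat \<Rightarrow> real measure) \<Rightarrow> (nat \<Rightarrow> real) \<Rightarrow> real \<Rightarrow> 'sig mechanism \<Rightarrow> bool" where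
  "admissible n DX c cdel M \<longleftrightarrow>
     (case M of NoDel p \<Rightarrow> valid_policy n {} p
      | Del Sig_set Sig \<Rightarrow> Sig_set \<noteq> {} \<and> (\<forall>s\<in>Sig_set. valid_policy n {} (Sig s))) \<and>
     (\<forall>DXY. agent_law n DX DXY \<longrightarrow>
        realized_util cdel c M \<in> borel_measurable (PiM {..<n} DXY))"

definition mech_value :: "nat \<Rightarrow> (nat \<Rightarrow> real measure) \<Rightarrow> (nat \<Rightarrow> real) \<Rightarrow> real \<Rightarrow> 'sig mechanism \<Rightarrow> real" where
  "mech_value n DX c cdel M =
     (INF DXY \<in> {DXY. agent_law n DX DXY}. integral\<^sup>L (PiM {..<n} DXY) (realized_util cdel c M))"

text \<open>SPMI with threshold tau; signals are Some j (propose j) and None (the signal bottom).\<close>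
definition SPMI :: "nat \<Rightarrow> (nat \<Rightarrow> real) \<Rightarrow> real \<Rightarrow> nat option mechanism" where
  "SPMI n c tau =
     Del (insert None (Some ` {..<n}))
         (\<lambda>s. case s of None \<Rightarrow> Stop
                | Some j \<Rightarrow> Inspect j (\<lambda>v. if tau \<le> v - c j then Select j else Stop))"

definition exp_max_net :: "nat \<Rightarrow> (nat \<Rightarrow> real measure) \<Rightarrow> (nat \<Rightarrow> real) \<Rightarrow> real" where
  "exp_max_net n DX c =
     integral\<^sup>L (PiM {..<n} DX) (\<lambda>x. MAX i\<in>{..<n}. max (x i - c i) 0)"

end

theory Submission
  imports Defs
begin

text \<open>Write \<open>V\<close> for the expected maximum of \<open>(X\<^sub>i - c\<^sub>i)\<^sup>+\<close> and \<open>m\<close> for the largest mean of an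
  \<open>X\<^sub>i\<close>. The candidate mechanism earns at least \<open>max m (V / 2)\<close>, so it is enough that no mechanism
  earns more than \<open>V + m\<close> against an agent whose utilities are positive, pairwise distinct
  constants.

  Let \<open>b\<^sub>k = min X\<^sub>k c\<^sub>k\<close>, with mean at most \<open>min m c\<^sub>k\<close>. A selected alternative that was inspected
  contributes at most \<open>max (X\<^sub>i - c\<^sub>i)\<^sup>+\<close>, one selected unseen at most \<open>b\<^sub>k\<close> more. Let \<open>P\<^sub>k\<close> be the
  event, depending only on the other values, that for some value of \<open>X\<^sub>k\<close> the agent can optimally get
  \<open>k\<close> selected unseen. On \<open>P\<^sub>k\<close>, an optimal signal either selects \<open>k\<close> or inspects \<open>k\<close>, and in the
  latter case the cost \<open>c\<^sub>k\<close> pays for the mean of \<open>b\<^sub>k\<close>. Hence the utility exceeds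
  \<open>max (X\<^sub>i - c\<^sub>i)\<^sup>+ + m\<close> by at most the sum of the centered variables \<open>b\<^sub>k - E b\<^sub>k\<close> over those \<open>k\<close> for
  which \<open>P\<^sub>k\<close> holds. That sum has mean zero if the \<open>P\<^sub>k\<close> are measurable. Policies and signal sets are
  arbitrary, so they need not be; a sampling argument replaces Fubini.\<close>

section \<open>Centered sums with non-measurable weights\<close>

text \<open>Points of the product space are extensional, so restricting to \<open>I\<close> is the
  identity there and the joint law of the coordinates is the product of their marginals.\<close>

lemma indep_vars_PiM_component:
  assumes M: "\<And>i. i \<in> I \<Longrightarrow> prob_space (M i)"
  shows "prob_space.indep_vars (PiM I M) M (\<lambda>i x. x i) I"
proof (cases "I = {}")
  case True
  interpret prob_space "PiM I M" by (intro prob_space_PiM M)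
  show ?thesis unfolding indep_vars_def indep_sets_def by (simp add: True)
next
  case False
  interpret prob_space "PiM I M" by (intro prob_space_PiM M)
  have "distr (PiM I M) (PiM I M) (\<lambda>x. \<lambda>i\<in>I. x i) = distr (PiM I M) (PiM I M) (\<lambda>x. x)"
    by (intro distr_cong) (auto simp: space_PiM PiE_def extensional_restrict)
  also have "\<dots> = PiM I M" by (rule distr_id2) simp
  also have "\<dots> = PiM I (\<lambda>i. distr (PiM I M) (M i) (\<lambda>x. x i))"
    by (intro PiM_cong) (auto simp: distr_PiM_component M)
  finally show ?thesis
    using False by (subst indep_vars_iff_distr_eq_PiM') auto
qed

text \<open>The L1 norm is at most the L2 norm, and by independence only the diagonal terms survive
  in the second moment. Growth like \<open>sqrt (card K)\<close> instead of \<open>card K\<close> is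
  what makes the averaging over samples below converge.\<close>

lemma integral_abs_sum_centered_PiM_le:
  fixes a :: "'i \<Rightarrow> 'a \<Rightarrow> real"
  assumes M: "\<And>i. i \<in> I \<Longrightarrow> prob_space (M i)"
    and K: "finite K" "K \<subseteq> I"
    and a_meas: "\<And>i. i \<in> K \<Longrightarrow> a i \<in> borel_measurable (M i)"
    and a_bound: "\<And>i x. i \<in> K \<Longrightarrow> \<bar>a i x\<bar> \<le> B"
    and a_mean: "\<And>i. i \<in> K \<Longrightarrow> (\<integral>x. a i x \<partial>M i) = 0"
    and B: "0 \<le> B"
  shows "(\<integral>x. \<bar>\<Sum>i\<in>K. a i (x i)\<bar> \<partial>PiM I M) \<le> B * sqrt (card K)"
proof -
  interpret prob_space "PiM I M" by (intro prob_space_PiM M)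
  define X where "X = (\<lambda>i x. a i (x i))"
  have X_meas: "X i \<in> borel_measurable (PiM I M)" if "i \<in> K" for i
    using that K unfolding X_def
    by (intro measurable_compose[OF measurable_component_singleton[of i I M] a_meas[OF that]]) auto
  have X_bound: "\<bar>X i x\<bar> \<le> B" if "i \<in> K" for i x
    using a_bound that by (simp add: X_def)
  have X_int: "integrable (PiM I M) (X i)" if "i \<in> K" for i
    using X_meas X_bound that by (intro integrable_const_bound[where B=B]) auto
  have X_mean: "expectation (X i) = 0" if "i \<in> K" for i
  proof -
    have "0 = (\<integral>x. a i x \<partial>distr (PiM I M) (M i) (\<lambda>x. x i))"
      using K that by (subst distr_PiM_component) (auto simp: M a_mean)
    also have "\<dots> = expectation (X i)"
      unfolding X_def using K that by (intro integral_distr) (auto intro: a_meas)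
    finally show ?thesis by simp
  qed
  have XX_int: "integrable (PiM I M) (\<lambda>x. X i x * X j x)" if "i \<in> K" "j \<in> K" for i j
    using X_meas X_bound that B
    by (intro integrable_const_bound[where B="B * B"]) (auto simp: abs_mult intro!: mult_mono)
  have indep: "indep_vars (\<lambda>_. borel) X K"
    unfolding X_def
    by (rule indep_vars_compose2[OF indep_vars_subset[OF indep_vars_PiM_component[OF M] K(2)]])
       (auto intro: a_meas)
  have cross: "expectation (\<lambda>x. X i x * X j x) = 0" if "i \<in> K" "j \<in> K" "i \<noteq> j" for i j
  proof -
    have "expectation (\<lambda>x. \<Prod>k\<in>{i, j}. X k x) = (\<Prod>k\<in>{i, j}. expectation (X k))"
      using that X_int by (intro indep_vars_lebesgue_integral indep_vars_subset[OF indep]) auto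
    then show ?thesis using that X_mean by simp
  qed
  have diag: "expectation (\<lambda>x. X i x * X i x) \<le> B\<^sup>2" if "i \<in> K" for i
  proof -
    have "X i x * X i x \<le> B\<^sup>2" for x
      using X_bound[OF that, of x] by (metis abs_le_square_iff abs_of_nonneg B power2_eq_square)
    then have "expectation (\<lambda>x. X i x * X i x) \<le> expectation (\<lambda>_. B\<^sup>2)"
      using XX_int that by (intro integral_mono) auto
    then show ?thesis by (simp add: prob_space)
  qed
  define S where "S = (\<lambda>x. \<bar>\<Sum>i\<in>K. X i x\<bar>)"
  have S2: "(S x)\<^sup>2 = (\<Sum>i\<in>K. \<Sum>j\<in>K. X i x * X j x)" for x
    by (simp add: S_def power2_eq_square sum_product)
  have S2_int: "integrable (PiM I M) (\<lambda>x. (S x)\<^sup>2)"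
    unfolding S2 by (intro Bochner_Integration.integrable_sum XX_int)
  have S_int: "integrable (PiM I M) S"
    unfolding S_def by (intro integrable_abs Bochner_Integration.integrable_sum X_int)
  have "expectation (\<lambda>x. (S x)\<^sup>2) = (\<Sum>i\<in>K. \<Sum>j\<in>K. expectation (\<lambda>x. X i x * X j x))"
    unfolding S2 by (simp add: XX_int)
  also have "\<dots> = (\<Sum>i\<in>K. expectation (\<lambda>x. X i x * X i x))"
  proof (intro sum.cong refl)
    fix i assume "i \<in> K"
    then show "(\<Sum>j\<in>K. expectation (\<lambda>x. X i x * X j x)) = expectation (\<lambda>x. X i x * X i x)"
      using cross K by (subst sum.remove[of K i]) (auto intro!: sum.neutral)
  qed
  also have "\<dots> \<le> (\<Sum>i\<in>K. B\<^sup>2)" by (intro sum_mono diag)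
  finally have *: "expectation (\<lambda>x. (S x)\<^sup>2) \<le> card K * B\<^sup>2" by simp
  have "(expectation S)\<^sup>2 \<le> expectation (\<lambda>x. (S x)\<^sup>2)"
    using variance_positive[of S] variance_eq[OF S_int S2_int] by simp
  also note *
  finally have "sqrt ((expectation S)\<^sup>2) \<le> sqrt (card K * B\<^sup>2)"
    by (rule real_sqrt_le_mono)
  then have "\<bar>expectation S\<bar> \<le> B * sqrt (card K)"
    using B by (simp add: real_sqrt_mult mult.commute)
  then show ?thesis by (simp add: S_def X_def)
qed

text \<open>Isolates the choice for coordinate \<open>i\<close>, so that a factor independent of
  that choice can be pulled out of the inner sum.\<close>

lemma sum_PiE_split:
  fixes f :: "('i \<Rightarrow> 'b) \<Rightarrow> 'c::comm_monoid_add"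
  assumes "i \<in> I"
  shows "(\<Sum>s\<in>I \<rightarrow>\<^sub>E A. f s) = (\<Sum>s\<in>(I - {i}) \<rightarrow>\<^sub>E A. \<Sum>j\<in>A. f (s(i := j)))"
proof -
  have "I \<rightarrow>\<^sub>E A = (\<lambda>(y, g). g(i := y)) ` (A \<times> ((I - {i}) \<rightarrow>\<^sub>E A))"
    using PiE_insert_eq[of i "I - {i}" "\<lambda>_. A"] assms by (simp add: insert_absorb)
  then have "(\<Sum>s\<in>I \<rightarrow>\<^sub>E A. f s) = (\<Sum>(j, s)\<in>A \<times> ((I - {i}) \<rightarrow>\<^sub>E A). f (s(i := j)))"
    using sum.reindex[OF inj_combinator[of i "I - {i}" "\<lambda>_. A"], of f]
    by (simp add: case_prod_unfold comp_def)
  also have "\<dots> = (\<Sum>j\<in>A. \<Sum>s\<in>(I - {i}) \<rightarrow>\<^sub>E A. f (s(i := j)))"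
    by (rule sum.cartesian_product[symmetric])
  finally show ?thesis by (subst (asm) sum.swap)
qed

text \<open>If every \<open>h i\<close> were measurable, Fubini would give the claim at once. In general, draw a
  sample of size \<open>N\<close> from each factor and average \<open>F\<close> over all \<open>N ^ card I\<close> ways of picking one
  sample point per coordinate: the expectation of \<open>F\<close> is unchanged, and the average is bounded by
  the empirical means of the \<open>a i\<close>, in which the \<open>h i\<close> no longer occur.\<close>
lemma integral_PiM_nonpos_of_le_centered:
  fixes F :: "('i \<Rightarrow> 'a) \<Rightarrow> real" and a :: "'i \<Rightarrow> 'a \<Rightarrow> real"
    and h :: "'i \<Rightarrow> ('i \<Rightarrow> 'a) \<Rightarrow> real"
  assumes M: "\<And>i. i \<in> I \<Longrightarrow> prob_space (M i)"
    and I: "finite I"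
    and F_int: "integrable (PiM I M) F"
    and a_meas: "\<And>i. i \<in> I \<Longrightarrow> a i \<in> borel_measurable (M i)"
    and a_bound: "\<And>i x. i \<in> I \<Longrightarrow> \<bar>a i x\<bar> \<le> B"
    and a_mean: "\<And>i. i \<in> I \<Longrightarrow> (\<integral>x. a i x \<partial>M i) = 0"
    and h_range: "\<And>i x. i \<in> I \<Longrightarrow> 0 \<le> h i x \<and> h i x \<le> 1"
    and h_indep: "\<And>i x v. i \<in> I \<Longrightarrow> h i (x(i := v)) = h i x"
    and F_le: "\<And>x. x \<in> space (PiM I M) \<Longrightarrow> F x \<le> (\<Sum>i\<in>I. h i x * a i (x i))"
  shows "(\<integral>x. F x \<partial>PiM I M) \<le> 0"
proof (cases "I = {}")
  case True
  then show ?thesis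
    using integral_mono[OF F_int, of "\<lambda>_. 0"] F_le by simp
next
  case False
  then obtain i0 where "i0 \<in> I" by blast
  then have B: "0 \<le> B" using a_bound[of i0 undefined] by linarith
  \<comment> \<open>The sample size \<open>N\<close> is free, and the bound tends to 0 as it
    grows.\<close>
  have main: "(\<integral>x. F x \<partial>PiM I M) \<le> card I * B / sqrt N" if N: "0 < N" for N :: nat
  proof -
    \<comment> \<open>Coordinate \<open>(i, j)\<close> holds the \<open>j\<close>-th draw from
      \<open>M i\<close>. A map \<open>s\<close> in \<open>T\<close> picks one draw for each
      \<open>i\<close>, and \<open>E i\<close> is \<open>N\<close> times the empirical mean of
      \<open>a i\<close>.\<close>
    define J where "J = I \<times> {..<N}"
    define MM where "MM = (\<lambda>p :: 'i \<times> nat. M (fst p))"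
    define T where "T = (I \<rightarrow>\<^sub>E {..<N})"
    define pick where "pick = (\<lambda>(s :: 'i \<Rightarrow> nat) w. \<lambda>i\<in>I. w (i, s i) :: 'a)"
    define E where "E = (\<lambda>i (w :: 'i \<times> nat \<Rightarrow> 'a). \<Sum>j<N. a i (w (i, j)))"
    have MM: "prob_space (MM p)" if "p \<in> J" for p
      using that M by (auto simp: MM_def J_def)
    interpret prob_space "PiM J MM" by (intro prob_space_PiM MM)
    have pick_meas: "pick s \<in> measurable (PiM J MM) (PiM I M)" if "s \<in> T" for s
      unfolding pick_def
    proof (rule measurable_restrict)
      fix i assume "i \<in> I"
      then have "(\<lambda>w. w (i, s i)) \<in> measurable (PiM J MM) (MM (i, s i))"
        using that by (intro measurable_component_singleton) (auto simp: J_def T_def)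
      then show "(\<lambda>w. w (i, s i)) \<in> measurable (PiM J MM) (M i)"
        by (simp add: MM_def)
    qed
    \<comment> \<open>The map sending \<open>i\<close> to \<open>(i, s i)\<close> is injective, so
      the picked draws are independent with the right marginals.\<close>
    have pick_distr: "distr (PiM J MM) (PiM I M) (pick s) = PiM I M" if "s \<in> T" for s
      using distr_PiM_reindex[of J MM "\<lambda>i. (i, s i)" I] MM that
      by (auto simp: MM_def pick_def J_def T_def inj_on_def)
    have Fpick_int: "integrable (PiM J MM) (\<lambda>w. F (pick s w))" if "s \<in> T" for s
      using integrable_distr[OF pick_meas[OF that], of F] pick_distr[OF that] F_int by simp
    have Fpick: "expectation (\<lambda>w. F (pick s w)) = (\<integral>x. F x \<partial>PiM I M)" if "s \<in> T" for s
      using integral_distr[OF pick_meas[OF that], of F] pick_distr[OF that] F_int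
      by simp
    have card_T: "card T = N ^ card I" using I by (simp add: T_def card_funcsetE)
    have E_int: "integrable (PiM J MM) (E i)" if "i \<in> I" for i
      unfolding E_def
    proof (intro Bochner_Integration.integrable_sum)
      fix j assume "j \<in> {..<N}"
      then have "(\<lambda>w. w (i, j)) \<in> measurable (PiM J MM) (MM (i, j))"
        using that by (intro measurable_component_singleton) (auto simp: J_def)
      then have "(\<lambda>w. a i (w (i, j))) \<in> borel_measurable (PiM J MM)"
        by (rule measurable_compose) (simp add: MM_def a_meas that)
      then show "integrable (PiM J MM) (\<lambda>w. a i (w (i, j)))"
        using a_bound that by (intro integrable_const_bound[where B=B]) auto
    qed
    have E_le: "expectation (\<lambda>w. \<bar>E i w\<bar>) \<le> B * sqrt N" if "i \<in> I" for i
    proof -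
      have "expectation (\<lambda>w. \<bar>\<Sum>p\<in>{i} \<times> {..<N}. a (fst p) (w p)\<bar>)
              \<le> B * sqrt (card ({i} \<times> {..<N}))"
        using that B a_bound a_mean a_meas
        by (intro integral_abs_sum_centered_PiM_le MM) (auto simp: J_def MM_def)
      also have "(\<lambda>w. \<bar>\<Sum>p\<in>{i} \<times> {..<N}. a (fst p) (w p)\<bar>) = (\<lambda>w. \<bar>E i w\<bar>)"
        by (simp add: E_def sum.cartesian_product')
      finally show ?thesis by (simp add: card_cartesian_product)
    qed
    have ptw: "(\<Sum>s\<in>T. F (pick s w)) \<le> (\<Sum>i\<in>I. N ^ (card I - 1) * \<bar>E i w\<bar>)"
      if w: "w \<in> space (PiM J MM)" for w
    proof -
      have "(\<Sum>s\<in>T. F (pick s w)) \<le> (\<Sum>s\<in>T. \<Sum>i\<in>I. h i (pick s w) * a i (pick s w i))"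
        using w pick_meas by (intro sum_mono F_le) (auto dest: measurable_space)
      also have "\<dots> = (\<Sum>i\<in>I. \<Sum>s\<in>T. h i (pick s w) * a i (w (i, s i)))"
        by (subst sum.swap) (simp add: pick_def)
      also have "\<dots> \<le> (\<Sum>i\<in>I. N ^ (card I - 1) * \<bar>E i w\<bar>)"
      proof (rule sum_mono)
        fix i assume i: "i \<in> I"
        \<comment> \<open>Another choice at \<open>i\<close> changes only coordinate
          \<open>i\<close> of the picked point, which \<open>h i\<close> ignores. The weight
          therefore factors out of the sum over the draws for \<open>i\<close>, leaving
          \<open>E i\<close>.\<close>
        have h_const: "h i (pick (s(i := j)) w) = h i (pick s w)" for s j
        proof -
          have "pick (s(i := j)) w = (pick s w)(i := w (i, j))"
            using i by (auto simp: pick_def fun_eq_iff)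
          then show ?thesis using h_indep i by simp
        qed
        have "(\<Sum>s\<in>T. h i (pick s w) * a i (w (i, s i)))
              = (\<Sum>s\<in>(I - {i}) \<rightarrow>\<^sub>E {..<N}. h i (pick s w) * E i w)"
          unfolding T_def using i
          by (subst sum_PiE_split[of i]) (simp_all add: h_const E_def sum_distrib_left)
        also have "\<dots> \<le> (\<Sum>s\<in>(I - {i}) \<rightarrow>\<^sub>E {..<N}. 1 * \<bar>E i w\<bar>)"
        proof (rule sum_mono)
          fix s
          have "h i (pick s w) * E i w \<le> h i (pick s w) * \<bar>E i w\<bar>"
            using h_range i by (intro mult_left_mono) auto
          also have "\<dots> \<le> 1 * \<bar>E i w\<bar>"
            using h_range i by (intro mult_right_mono) auto
          finally show "h i (pick s w) * E i w \<le> 1 * \<bar>E i w\<bar>" .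
        qed
        also have "\<dots> = N ^ (card I - 1) * \<bar>E i w\<bar>"
          using I i by (simp add: card_funcsetE)
        finally show "(\<Sum>s\<in>T. h i (pick s w) * a i (w (i, s i))) \<le> N ^ (card I - 1) * \<bar>E i w\<bar>" .
      qed
      finally show ?thesis .
    qed
    \<comment> \<open>Only the two outer sides of \<open>ptw\<close> are integrated; both are
      integrable, whatever the \<open>h i\<close> are. The factor \<open>N ^ card I\<close> on the
      left against \<open>N ^ (card I - 1) * sqrt N\<close> on the right leaves
      \<open>1 / sqrt N\<close>.\<close>
    have "real N ^ card I * (\<integral>x. F x \<partial>PiM I M) = (\<Sum>s\<in>T. expectation (\<lambda>w. F (pick s w)))"
      by (simp add: Fpick card_T)
    also have "\<dots> = expectation (\<lambda>w. \<Sum>s\<in>T. F (pick s w))"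
      by (simp add: Fpick_int)
    also have "\<dots> \<le> expectation (\<lambda>w. \<Sum>i\<in>I. N ^ (card I - 1) * \<bar>E i w\<bar>)"
      using Fpick_int E_int ptw
      by (intro integral_mono Bochner_Integration.integrable_sum integrable_mult_right integrable_abs)
         auto
    also have "\<dots> = (\<Sum>i\<in>I. N ^ (card I - 1) * expectation (\<lambda>w. \<bar>E i w\<bar>))"
      using E_int by simp
    also have "\<dots> \<le> (\<Sum>i\<in>I. N ^ (card I - 1) * (B * sqrt N))"
      by (intro sum_mono mult_left_mono E_le) auto
    also have "\<dots> = real N ^ (card I - 1) * (card I * B * sqrt N)" by simp
    also have "real N ^ card I = real N ^ (card I - 1) * N"
      using False I by (metis card_gt_0_iff power_minus_mult)
    finally have "N * (\<integral>x. F x \<partial>PiM I M) \<le> card I * B * sqrt N"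
      using N by (simp add: mult.assoc)
    moreover have "N * (\<integral>x. F x \<partial>PiM I M) = sqrt N * (sqrt N * (\<integral>x. F x \<partial>PiM I M))"
      by (simp flip: mult.assoc)
    ultimately have "sqrt N * (sqrt N * (\<integral>x. F x \<partial>PiM I M)) \<le> sqrt N * (card I * B)"
      by (simp add: algebra_simps)
    then have "sqrt N * (\<integral>x. F x \<partial>PiM I M) \<le> card I * B" using N by simp
    then show ?thesis using N by (simp add: field_simps)
  qed
  have "(\<lambda>N. card I * B / sqrt (real N)) \<longlonglongrightarrow> 0"
    by (intro real_tendsto_divide_at_top[OF tendsto_const]
        filterlim_compose[OF sqrt_at_top filterlim_real_sequentially])
  then show ?thesis
    using main by (intro tendsto_lowerbound[of _ 0 sequentially])
      (auto intro!: eventually_sequentiallyI[of 1])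
qed

section \<open>Policies and optimal signals\<close>

text \<open>A policy reads values only by inspecting. Selecting reads nothing, so \<open>k\<close>
  may well be the selected alternative.\<close>

lemma outcome_fun_upd:
  "k \<notin> set (snd (outcome p x)) \<Longrightarrow> outcome p (x(k := v)) = outcome p x"
  by (induction p) (auto simp: Let_def)

lemma valid_policy_inspected:
  "valid_policy n S p \<Longrightarrow>
     distinct (snd (outcome p x)) \<and> set (snd (outcome p x)) \<subseteq> {..<n} - S"
proof (induction p arbitrary: S)
  case (Inspect i f)
  then have "distinct (snd (outcome (f (x i)) x)) \<and>
      set (snd (outcome (f (x i)) x)) \<subseteq> {..<n} - insert i S"
    by (intro Inspect.IH) auto
  then show ?case using Inspect.prems by (auto simp: Let_def)
qed auto

lemma valid_policy_selected:
  "valid_policy n S p \<Longrightarrow> fst (outcome p x) = Some k \<Longrightarrow> k < n"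
proof (induction p arbitrary: S)
  case (Inspect i f)
  then show ?case using Inspect.IH[of "f (x i)" "insert i S"] by (auto simp: Let_def)
qed auto

lemma principal_util_valid:
  assumes "valid_policy n {} p"
  shows "principal_util c p x =
    (case fst (outcome p x) of None \<Rightarrow> 0 | Some k \<Rightarrow> x k) - sum c (set (snd (outcome p x)))"
  using valid_policy_inspected[OF assms, of x]
  by (simp add: principal_util_def Let_def sum_list_distinct_conv_sum_set)

text \<open>The bound is the same for all policies, hence survives the supremum over signals and
  serves as integrable majorant.\<close>

lemma abs_principal_util_le:
  assumes p: "valid_policy n {} p" and c: "\<forall>i<n. 0 \<le> c i"
  shows "\<bar>principal_util c p x\<bar> \<le> (\<Sum>i<n. \<bar>x i\<bar>) + (\<Sum>i<n. c i)"
proof -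
  have sub: "set (snd (outcome p x)) \<subseteq> {..<n}"
    using valid_policy_inspected[OF p, of x] by auto
  have "0 \<le> sum c (set (snd (outcome p x)))"
    using sub c by (intro sum_nonneg) auto
  moreover have "sum c (set (snd (outcome p x))) \<le> (\<Sum>i<n. c i)"
    using sub c by (intro sum_mono2) auto
  moreover have "\<bar>case fst (outcome p x) of None \<Rightarrow> 0 | Some k \<Rightarrow> x k\<bar> \<le> (\<Sum>i<n. \<bar>x i\<bar>)"
    using valid_policy_selected[OF p, of x]
    by (auto split: option.split intro!: sum_nonneg member_le_sum[of _ "{..<n}" "\<lambda>i. \<bar>x i\<bar>"])
  ultimately show ?thesis unfolding principal_util_valid[OF p] by linarith
qed

section \<open>Signals that are optimal for the agent\<close>

definition agent_optimal ::
  "'sig set \<Rightarrow> ('sig \<Rightarrow> policy) \<Rightarrow> (nat \<Rightarrow> real) \<Rightarrow> (nat \<Rightarrow> real) \<Rightarrow> 'sig \<Rightarrow> bool" where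
  "agent_optimal Sigs Sig y x s \<longleftrightarrow>
     s \<in> Sigs \<and> (\<forall>s'\<in>Sigs. agent_util (Sig s') x y \<le> agent_util (Sig s) x y)"

lemma realized_util_Del:
  "realized_util cdel c (Del Sigs Sig) w =
     Sup {principal_util c (Sig s) (\<lambda>i. fst (w i)) | s.
       agent_optimal Sigs Sig (\<lambda>i. snd (w i)) (\<lambda>i. fst (w i)) s} - cdel"
  by (simp add: agent_optimal_def)

text \<open>A single signal leaves the agent no choice. At delegation cost 0, mechanisms without
  delegation therefore need no separate treatment.\<close>

lemma realized_util_NoDel_eq_Del:
  "realized_util 0 c (NoDel p) = realized_util 0 c (Del {s} (\<lambda>_. p))"
  by (simp add: fun_eq_iff)

text \<open>The signal set may be infinite, but the agent's utility takes at most
  \<open>n + 1\<close> values on it, so the maximum is attained.\<close>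

lemma agent_optimal_exists:
  assumes "Sigs \<noteq> {}" and valid: "\<forall>s\<in>Sigs. valid_policy n {} (Sig s)"
  shows "\<exists>s. agent_optimal Sigs Sig y x s"
proof -
  let ?A = "(\<lambda>s. agent_util (Sig s) x y) ` Sigs"
  have "?A \<subseteq> insert 0 (y ` {..<n})"
    using valid valid_policy_selected by (fastforce simp: agent_util_def split: option.split)
  then have fin: "finite ?A" by (rule finite_subset) simp
  then have "Max ?A \<in> ?A" using assms by (intro Max_in) auto
  then obtain s where "s \<in> Sigs" "agent_util (Sig s) x y = Max ?A" by auto
  then show ?thesis using fin by (auto simp: agent_optimal_def intro!: exI[of _ s])
qed

text \<open>The event \<open>P\<^sub>k\<close> of the introduction.\<close>
definition selectable_unseen ::
  "'sig set \<Rightarrow> ('sig \<Rightarrow> policy) \<Rightarrow> (nat \<Rightarrow> real) \<Rightarrow> nat \<Rightarrow> (nat \<Rightarrow> real) \<Rightarrow> bool" where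
  "selectable_unseen Sigs Sig y k x \<longleftrightarrow>
     (\<exists>v s. agent_optimal Sigs Sig y (x(k := v)) s \<and>
        fst (outcome (Sig s) (x(k := v))) = Some k \<and>
        k \<notin> set (snd (outcome (Sig s) (x(k := v)))))"

lemma selectable_unseen_fun_upd:
  "selectable_unseen Sigs Sig y k (x(k := v)) = selectable_unseen Sigs Sig y k x"
  by (simp add: selectable_unseen_def)

text \<open>If an optimal signal does not inspect \<open>k\<close>, it is not affected by a change of \<open>x k\<close>, so it
  competes with the signal that obtains \<open>k\<close> unseen; as the agent's utilities are distinct, both
  select \<open>k\<close>.\<close>
lemma selectable_unseen_selected_or_inspected:
  assumes valid: "\<forall>s\<in>Sigs. valid_policy n {} (Sig s)"
    and y_inj: "inj_on y {..<n}" and y_pos: "\<forall>i<n. 0 < y i"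
    and opt: "agent_optimal Sigs Sig y x s"
    and k: "selectable_unseen Sigs Sig y k x"
  shows "fst (outcome (Sig s) x) = Some k \<or> k \<in> set (snd (outcome (Sig s) x))"
proof (rule disjCI)
  assume "k \<notin> set (snd (outcome (Sig s) x))"
  then have same: "outcome (Sig s) (x(k := v)) = outcome (Sig s) x" for v
    by (rule outcome_fun_upd)
  obtain v s' where opt': "agent_optimal Sigs Sig y (x(k := v)) s'"
    and sel: "fst (outcome (Sig s') (x(k := v))) = Some k"
    and unseen: "k \<notin> set (snd (outcome (Sig s') (x(k := v))))"
    using k unfolding selectable_unseen_def by blast
  \<comment> \<open>The run of \<open>Sig s'\<close> does not read \<open>x k\<close> either. Both
    optimality conditions thus compare the same two outcomes, in opposite directions.\<close>
  have sel': "fst (outcome (Sig s') x) = Some k"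
    using outcome_fun_upd[OF unseen, of "x k"] sel by simp
  have ss': "s \<in> Sigs" "s' \<in> Sigs" using opt opt' by (auto simp: agent_optimal_def)
  have "k < n" using valid_policy_selected[OF _ sel'] valid ss' by blast
  have "agent_util (Sig s') x y \<le> agent_util (Sig s) x y"
    using opt ss' by (auto simp: agent_optimal_def)
  then have 1: "y k \<le> agent_util (Sig s) x y" by (simp add: agent_util_def sel')
  have "agent_util (Sig s) (x(k := v)) y \<le> agent_util (Sig s') (x(k := v)) y"
    using opt' ss' by (auto simp: agent_optimal_def)
  then have 2: "agent_util (Sig s) x y \<le> y k" by (simp add: agent_util_def sel same)
  show "fst (outcome (Sig s) x) = Some k"
  proof (cases "fst (outcome (Sig s) x)")
    case None
    then show ?thesis using 1 y_pos \<open>k < n\<close> by (auto simp: agent_util_def)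
  next
    case (Some k')
    then have "y k' = y k" using 1 2 by (simp add: agent_util_def)
    moreover have "k' < n" using valid_policy_selected[OF _ Some] valid ss' by blast
    ultimately have "k' = k" using y_inj \<open>k < n\<close> by (auto dest: inj_onD)
    then show ?thesis using Some by simp
  qed
qed

text \<open>Every member of \<open>P\<close> other than the selected alternative was inspected, and
  its cost pays for its summand, which is at least \<open>- c k\<close>. The selected alternative is
  accounted for by \<open>Z\<close> and \<open>m\<close>. The numbers \<open>\<beta>\<close> become
  the means of the truncated values.\<close>

lemma principal_util_optimal_le:
  fixes n :: nat and c x y \<beta> :: "nat \<Rightarrow> real"
  assumes valid: "\<forall>s\<in>Sigs. valid_policy n {} (Sig s)"
    and y_inj: "inj_on y {..<n}" and y_pos: "\<forall>i<n. 0 < y i"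
    and opt: "agent_optimal Sigs Sig y x s"
    and c: "\<forall>i<n. 0 \<le> c i"
    and \<beta>: "\<forall>i<n. \<beta> i \<le> c i \<and> \<beta> i \<le> m" and m: "0 \<le> m"
    and Z: "0 \<le> Z" "\<forall>i<n. x i - c i \<le> Z"
  shows "principal_util c (Sig s) x - Z - m \<le>
    (\<Sum>k<n. of_bool (selectable_unseen Sigs Sig y k x) * (max 0 (min (x k) (c k)) - \<beta> k))"
proof -
  define P where "P = {k. k < n \<and> selectable_unseen Sigs Sig y k x}"
  define D where "D = set (snd (outcome (Sig s) x))"
  define b where "b k = max 0 (min (x k) (c k))" for k
  have P: "finite P" "P \<subseteq> {..<n}" by (auto simp: P_def)
  have s: "valid_policy n {} (Sig s)" using opt valid by (auto simp: agent_optimal_def)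
  have D: "finite D" "D \<subseteq> {..<n}" using valid_policy_inspected[OF s, of x] by (auto simp: D_def)
  have rhs: "(\<Sum>k<n. of_bool (selectable_unseen Sigs Sig y k x) * (b k - \<beta> k)) = (\<Sum>k\<in>P. b k - \<beta> k)"
    by (rule sum.mono_neutral_cong_right) (auto simp: P_def)
  have b_ge: "- c k \<le> b k - \<beta> k" if "k < n" for k
    using \<beta> that by (auto simp: b_def intro: order_trans[of _ 0])
  have lower: "- sum c Q \<le> (\<Sum>k\<in>Q. b k - \<beta> k)" if "Q \<subseteq> {..<n}" for Q
    unfolding sum_negf[symmetric] using that by (intro sum_mono b_ge) auto
  have P_D: "fst (outcome (Sig s) x) = Some k \<or> k \<in> D" if "k \<in> P" for k
    using selectable_unseen_selected_or_inspected[OF valid y_inj y_pos opt] that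
    by (auto simp: P_def D_def)
  have util: "principal_util c (Sig s) x =
      (case fst (outcome (Sig s) x) of None \<Rightarrow> 0 | Some k \<Rightarrow> x k) - sum c D"
    unfolding D_def by (rule principal_util_valid[OF s])
  have "principal_util c (Sig s) x - Z - m \<le> (\<Sum>k\<in>P. b k - \<beta> k)"
  proof (cases "fst (outcome (Sig s) x)")
    case None
    then have "P \<subseteq> D" using P_D by auto
    then have "sum c P \<le> sum c D" using D c by (intro sum_mono2) auto
    then show ?thesis using lower[OF P(2)] util None Z m by simp
  next
    case (Some k)
    then have k: "k < n" using valid_policy_selected[OF s] by blast
    let ?Q = "P - {k}"
    have Q: "?Q \<subseteq> D - {k}" using P_D Some by auto
    have lowQ: "- sum c ?Q \<le> (\<Sum>i\<in>?Q. b i - \<beta> i)" using P by (intro lower) auto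
    have split: "(\<Sum>i\<in>P. b i - \<beta> i) = (\<Sum>i\<in>?Q. b i - \<beta> i) + (if k \<in> P then b k - \<beta> k else 0)"
      using P by (simp add: sum.remove)
    have QD: "sum c ?Q \<le> sum c (D - {k})" using D c Q by (intro sum_mono2) auto
    show ?thesis
    proof (cases "k \<in> D")
      case True
      then have "sum c D = c k + sum c (D - {k})" using D by (simp add: sum.remove)
      \<comment> \<open>The cost \<open>c k\<close> is already used up in
        \<open>x k - c k \<le> Z\<close>, so here \<open>m\<close> absorbs the summand of
        \<open>k\<close>.\<close>
      moreover have "- m \<le> (if k \<in> P then b k - \<beta> k else 0)"
        using \<beta> k m by (auto simp: b_def intro: order_trans[of _ 0])
      moreover have "x k - c k \<le> Z" using Z k by simp
      ultimately show ?thesis using util Some lowQ QD split by simp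
    next
      case False
      \<comment> \<open>The actual value \<open>x k\<close> and the signal \<open>s\<close> are
        themselves the witnesses.\<close>
      then have "selectable_unseen Sigs Sig y k x"
        using opt Some unfolding selectable_unseen_def D_def
        by (intro exI[of _ "x k"] exI[of _ s]) simp
      then have kP: "k \<in> P" using k by (simp add: P_def)
      have "x k \<le> Z + b k" using Z k by (auto simp: b_def max_def min_def)
      moreover have "\<beta> k \<le> m" using \<beta> k by simp
      moreover have "sum c D = sum c (D - {k})" using False by simp
      ultimately show ?thesis using util Some lowQ QD split kP by simp
    qed
  qed
  then show ?thesis unfolding rhs[symmetric] by (simp only: b_def)
qed

lemma realized_util_Del_le:
  assumes "Sigs \<noteq> {}" and valid: "\<forall>s\<in>Sigs. valid_policy n {} (Sig s)"
    and "\<And>s. agent_optimal Sigs Sig (\<lambda>i. snd (w i)) (\<lambda>i. fst (w i)) s \<Longrightarrow>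
           principal_util c (Sig s) (\<lambda>i. fst (w i)) \<le> u"
  shows "realized_util 0 c (Del Sigs Sig) w \<le> u"
  unfolding realized_util_Del
  using agent_optimal_exists[OF assms(1,2), of "\<lambda>i. snd (w i)" "\<lambda>i. fst (w i)"] assms(3)
  by (auto intro!: cSup_least)

lemma abs_realized_util_Del_le:
  assumes "Sigs \<noteq> {}" and valid: "\<forall>s\<in>Sigs. valid_policy n {} (Sig s)"
    and c: "\<forall>i<n. 0 \<le> c i"
  shows "\<bar>realized_util 0 c (Del Sigs Sig) w\<bar> \<le> (\<Sum>i<n. \<bar>fst (w i)\<bar>) + (\<Sum>i<n. c i)"
  unfolding realized_util_Del diff_0_right
proof (rule cSup_abs_le)
  show "{principal_util c (Sig s) (\<lambda>i. fst (w i)) | s.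
       agent_optimal Sigs Sig (\<lambda>i. snd (w i)) (\<lambda>i. fst (w i)) s} \<noteq> {}"
    using agent_optimal_exists[OF assms(1,2)] by blast
qed (use abs_principal_util_le[OF _ c] valid in \<open>auto simp: agent_optimal_def\<close>)

section \<open>Agent laws and the value of a mechanism\<close>

lemma agent_law_measurable_fst:
  assumes "agent_law n DX DXY" and "\<forall>i<n. sets (DX i) = sets borel" and "i < n"
  shows "fst \<in> measurable (DXY i) (DX i)"
proof -
  have "(fst :: real \<times> real \<Rightarrow> real) \<in> borel_measurable borel"
    by (intro borel_measurable_continuous_onI continuous_intros)
  then show ?thesis
    using assms by (simp add: agent_law_def cong: measurable_cong_sets)
qed

lemma agent_law_distr_component:
  assumes law: "agent_law n DX DXY" and DX: "\<forall>i<n. sets (DX i) = sets borel" and i: "i < n"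
  shows "(\<lambda>w. fst (w i)) \<in> measurable (PiM {..<n} DXY) (DX i)"
    and "distr (PiM {..<n} DXY) (DX i) (\<lambda>w. fst (w i)) = DX i"
proof -
  have fst: "distr (DXY i) borel fst = DX i"
    using law i by (auto simp: agent_law_def)
  have prob: "prob_space (DXY j)" if "j \<in> {..<n}" for j
    using law that by (auto simp: agent_law_def)
  have comp: "(\<lambda>w. w i) \<in> measurable (PiM {..<n} DXY) (DXY i)"
    using i by (intro measurable_component_singleton) auto
  note fst_meas = agent_law_measurable_fst[OF law DX i]
  show "(\<lambda>w. fst (w i)) \<in> measurable (PiM {..<n} DXY) (DX i)"
    by (rule measurable_compose[OF comp fst_meas])
  have "distr (PiM {..<n} DXY) (DX i) (\<lambda>w. fst (w i))
        = distr (distr (PiM {..<n} DXY) (DXY i) (\<lambda>w. w i)) (DX i) fst"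
    using distr_distr[OF fst_meas comp] by (simp add: comp_def)
  also have "\<dots> = distr (DXY i) (DX i) fst"
    using i prob by (subst distr_PiM_component) auto
  also have "\<dots> = distr (DXY i) borel fst"
    using DX i by (intro distr_cong) auto
  finally show "distr (PiM {..<n} DXY) (DX i) (\<lambda>w. fst (w i)) = DX i"
    using fst by simp
qed

lemma agent_law_component:
  fixes f :: "real \<Rightarrow> real"
  assumes law: "agent_law n DX DXY" and DX: "\<forall>i<n. sets (DX i) = sets borel" and i: "i < n"
    and f: "f \<in> borel_measurable borel"
  shows "integrable (PiM {..<n} DXY) (\<lambda>w. f (fst (w i))) \<longleftrightarrow> integrable (DX i) f"
    and "(\<integral>w. f (fst (w i)) \<partial>PiM {..<n} DXY) = (\<integral>x. f x \<partial>DX i)"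
proof -
  note comp = agent_law_distr_component[OF law DX i]
  have f': "f \<in> borel_measurable (DX i)"
    using f DX i by (simp cong: measurable_cong_sets)
  show "integrable (PiM {..<n} DXY) (\<lambda>w. f (fst (w i))) \<longleftrightarrow> integrable (DX i) f"
    using integrable_distr_eq[OF comp(1) f'] comp(2) by simp
  show "(\<integral>w. f (fst (w i)) \<partial>PiM {..<n} DXY) = (\<integral>x. f x \<partial>DX i)"
    using integral_distr[OF comp(1) f'] comp(2) by simp
qed

text \<open>The joint law of the principal's values is the same for every agent. Using
  \<open>compose\<close> keeps the projected point extensional.\<close>

lemma agent_law_distr_PiM:
  assumes law: "agent_law n DX DXY"
    and DX: "\<forall>i<n. prob_space (DX i) \<and> sets (DX i) = sets borel"
  shows "compose {..<n} fst \<in> measurable (PiM {..<n} DXY) (PiM {..<n} DX)"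
    and "distr (PiM {..<n} DXY) (PiM {..<n} DX) (compose {..<n} fst) = PiM {..<n} DX"
proof -
  have fst_meas: "fst \<in> measurable (DXY i) (DX i)" if "i < n" for i
    using DX by (intro agent_law_measurable_fst[OF law _ that]) simp
  show "compose {..<n} fst \<in> measurable (PiM {..<n} DXY) (PiM {..<n} DX)"
    unfolding compose_def
  proof (rule measurable_restrict)
    fix i assume i: "i \<in> {..<n}"
    then show "(\<lambda>w. fst (w i)) \<in> measurable (PiM {..<n} DXY) (DX i)"
      by (intro measurable_compose[OF measurable_component_singleton[OF i] fst_meas]) simp
  qed
  have "distr (PiM {..<n} DXY) (PiM {..<n} DX) (compose {..<n} fst)
      = PiM {..<n} (\<lambda>i. distr (DXY i) (DX i) fst)"
    using law DX fst_meas
    by (intro distr_PiM_finite_prob_space') (auto simp: agent_law_def)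
  also have "\<dots> = PiM {..<n} DX"
  proof (intro PiM_cong refl)
    fix i assume i: "i \<in> {..<n}"
    then have "distr (DXY i) (DX i) fst = distr (DXY i) borel fst"
      using DX by (intro distr_cong) auto
    then show "distr (DXY i) (DX i) fst = DX i" using law i by (simp add: agent_law_def)
  qed
  finally show "distr (PiM {..<n} DXY) (PiM {..<n} DX) (compose {..<n} fst) = PiM {..<n} DX" .
qed

section \<open>Agents with deterministic utilities\<close>

definition constant_agent :: "(nat \<Rightarrow> real measure) \<Rightarrow> (nat \<Rightarrow> real) \<Rightarrow> nat \<Rightarrow> (real \<times> real) measure" where
  "constant_agent DX y i = distr (DX i) borel (\<lambda>x. (x, y i))"

lemma measurable_Pair_const_borel:
  fixes v :: real
  assumes "sets M = sets (borel :: real measure)"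
  shows "(\<lambda>x. (x, v)) \<in> measurable M borel"
proof -
  have "(\<lambda>x :: real. (x, v)) \<in> measurable borel borel"
    by (intro borel_measurable_continuous_onI continuous_intros)
  then show ?thesis using assms by (simp cong: measurable_cong_sets)
qed

lemma AE_constant_agent:
  assumes "sets (DX i) = sets borel"
  shows "AE p in constant_agent DX y i. snd p = y i"
proof -
  have "closed {p :: real \<times> real. snd p = y i}"
    by (intro closed_Collect_eq continuous_intros)
  then show ?thesis
    unfolding constant_agent_def
    by (subst AE_distr_iff[OF measurable_Pair_const_borel[OF assms]]) auto
qed

text \<open>A mechanism value is an infimum over agents, so one such agent suffices for upper
  bounds. It also shows that agent laws exist.\<close>

lemma agent_law_constant_agent:
  assumes DX: "\<forall>i<n. prob_space (DX i) \<and> sets (DX i) = sets borel"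
    and y: "\<forall>i<n. 0 \<le> y i"
  shows "agent_law n DX (constant_agent DX y)"
  unfolding agent_law_def
proof (intro allI impI conjI)
  fix i assume i: "i < n"
  note meas = measurable_Pair_const_borel[of "DX i" "y i"]
  show "prob_space (constant_agent DX y i)"
    unfolding constant_agent_def using DX i meas by (intro prob_space.prob_space_distr) auto
  show "sets (constant_agent DX y i) = sets borel" by (simp add: constant_agent_def)
  have "distr (constant_agent DX y i) borel fst = distr (DX i) borel (fst \<circ> (\<lambda>x. (x, y i)))"
    unfolding constant_agent_def using DX i meas
    by (intro distr_distr) (auto intro!: borel_measurable_continuous_onI continuous_intros)
  also have "\<dots> = DX i" using DX i by (simp add: comp_def distr_id2)
  finally show "distr (constant_agent DX y i) borel fst = DX i" .
  show "AE p in constant_agent DX y i. 0 \<le> snd p"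
    using AE_constant_agent[of DX i y] DX i y by (auto elim!: eventually_mono)
qed

text \<open>The second bound does not mention the agent, so it bounds from below the set whose
  infimum is the mechanism value.\<close>

lemma integrable_realized_util_Del:
  assumes law: "agent_law n DX DXY" and DX: "\<forall>i<n. sets (DX i) = sets borel"
    and DX_int: "\<forall>i<n. integrable (DX i) (\<lambda>x. x)"
    and c: "\<forall>i<n. 0 \<le> c i"
    and Sigs: "Sigs \<noteq> {}" and valid: "\<forall>s\<in>Sigs. valid_policy n {} (Sig s)"
    and meas: "realized_util 0 c (Del Sigs Sig) \<in> borel_measurable (PiM {..<n} DXY)"
  shows "integrable (PiM {..<n} DXY) (realized_util 0 c (Del Sigs Sig))"
    and "\<bar>\<integral>w. realized_util 0 c (Del Sigs Sig) w \<partial>PiM {..<n} DXY\<bar>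
      \<le> (\<Sum>i<n. \<integral>x. \<bar>x\<bar> \<partial>DX i) + (\<Sum>i<n. c i)"
proof -
  interpret prob_space "PiM {..<n} DXY"
    using law by (intro prob_space_PiM) (auto simp: agent_law_def)
  let ?U = "realized_util 0 c (Del Sigs Sig)"
  let ?b = "\<lambda>w :: nat \<Rightarrow> real \<times> real. (\<Sum>i<n. \<bar>fst (w i)\<bar>) + (\<Sum>i<n. c i)"
  have comp_int: "integrable (PiM {..<n} DXY) (\<lambda>w. \<bar>fst (w i)\<bar>)" if "i < n" for i
    using agent_law_component(1)[OF law DX that, of abs] DX_int that by simp
  then have b_int: "integrable (PiM {..<n} DXY) ?b"
    by (intro Bochner_Integration.integrable_add Bochner_Integration.integrable_sum) auto
  have U_le: "\<bar>?U w\<bar> \<le> ?b w" for w by (rule abs_realized_util_Del_le[OF Sigs valid c])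
  show int: "integrable (PiM {..<n} DXY) ?U"
    using U_le by (intro Bochner_Integration.integrable_bound[OF b_int meas] always_eventually)
      (auto intro: order_trans[OF _ abs_ge_self])
  have "\<bar>expectation ?U\<bar> \<le> expectation (\<lambda>w. \<bar>?U w\<bar>)" by (rule integral_abs_bound)
  also have "\<dots> \<le> expectation ?b"
    using int b_int U_le by (intro integral_mono integrable_abs)
  also have "\<dots> = (\<Sum>i<n. \<integral>x. \<bar>x\<bar> \<partial>DX i) + (\<Sum>i<n. c i)"
    using comp_int agent_law_component(2)[OF law DX, of _ abs]
    by (subst Bochner_Integration.integral_add)
       (auto simp: prob_space Bochner_Integration.integral_sum intro!: Bochner_Integration.integrable_sum)
  finally show "\<bar>expectation ?U\<bar> \<le> (\<Sum>i<n. \<integral>x. \<bar>x\<bar> \<partial>DX i) + (\<Sum>i<n. c i)" .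
qed

lemma exp_max_net_eq_integral:
  assumes n: "0 < n" and law: "agent_law n DX DXY"
    and DX: "\<forall>i<n. prob_space (DX i) \<and> sets (DX i) = sets borel"
    and DX_int: "\<forall>i<n. integrable (DX i) (\<lambda>x. x)"
    and c: "\<forall>i<n. 0 \<le> c i"
  shows "integrable (PiM {..<n} DXY) (\<lambda>w. MAX i\<in>{..<n}. max (fst (w i) - c i) 0)"
    and "(\<integral>w. (MAX i\<in>{..<n}. max (fst (w i) - c i) 0) \<partial>PiM {..<n} DXY) = exp_max_net n DX c"
proof -
  have DX_sets: "\<forall>i<n. sets (DX i) = sets borel" using DX by simp
  let ?Z = "\<lambda>x. MAX i\<in>{..<n}. max (x i - c i) 0"
  have comp: "(\<lambda>x. x i) \<in> borel_measurable (PiM {..<n} DX)" if "i < n" for i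
    using measurable_component_singleton[of i "{..<n}" DX] that DX
    by (simp cong: measurable_cong_sets)
  have Z_meas: "?Z \<in> borel_measurable (PiM {..<n} DX)"
    using comp by (intro borel_measurable_Max borel_measurable_max borel_measurable_diff) auto
  note D = agent_law_distr_PiM[OF law DX]
  have Z_compose: "?Z (compose {..<n} fst w) = ?Z (\<lambda>i. fst (w i))" for w :: "nat \<Rightarrow> real \<times> real"
    by (intro arg_cong[where f=Max] image_cong) (auto simp: compose_def)
  show "(\<integral>w. ?Z (\<lambda>i. fst (w i)) \<partial>PiM {..<n} DXY) = exp_max_net n DX c"
    using integral_distr[OF D(1) Z_meas] D(2) by (simp add: exp_max_net_def Z_compose)
  have meas: "(\<lambda>w. ?Z (\<lambda>i. fst (w i))) \<in> borel_measurable (PiM {..<n} DXY)"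
    using measurable_compose[OF D(1) Z_meas] by (simp add: Z_compose)
  have comp_int: "integrable (PiM {..<n} DXY) (\<lambda>w. \<bar>fst (w i)\<bar>)" if "i < n" for i
    using agent_law_component(1)[OF law DX_sets that, of abs] DX_int that by simp
  then have sum_int: "integrable (PiM {..<n} DXY) (\<lambda>w. \<Sum>i<n. \<bar>fst (w i)\<bar>)"
    by (intro Bochner_Integration.integrable_sum) auto
  have Z_le: "\<bar>?Z x\<bar> \<le> (\<Sum>i<n. \<bar>x i\<bar>)" for x :: "nat \<Rightarrow> real"
  proof -
    have "max (x i - c i) 0 \<le> (\<Sum>i<n. \<bar>x i\<bar>)" if "i < n" for i
    proof -
      have "max (x i - c i) 0 \<le> \<bar>x i\<bar>" using c that by auto
      also have "\<dots> \<le> (\<Sum>i<n. \<bar>x i\<bar>)"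
        using that by (intro member_le_sum) auto
      finally show ?thesis .
    qed
    then have "?Z x \<le> (\<Sum>i<n. \<bar>x i\<bar>)" using n by (intro Max.boundedI) auto
    moreover have "0 \<le> ?Z x" using n by (subst Max_ge_iff) auto
    ultimately show ?thesis by simp
  qed
  show "integrable (PiM {..<n} DXY) (\<lambda>w. ?Z (\<lambda>i. fst (w i)))"
    using Z_le by (intro Bochner_Integration.integrable_bound[OF sum_int meas] always_eventually)
      (auto intro: order_trans[OF _ abs_ge_self])
qed

text \<open>The pointwise bound \<open>principal_util_optimal_le\<close> puts the excess over
  \<open>Z\<close> and \<open>m\<close> below a centered sum, and
  \<open>integral_PiM_nonpos_of_le_centered\<close> removes that sum although its weights need not
  be measurable.\<close>

lemma integral_realized_util_constant_agent_le:
  fixes n :: nat and DX :: "nat \<Rightarrow> real measure" and c y :: "nat \<Rightarrow> real"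
  assumes n: "0 < n"
    and DX: "\<forall>i<n. prob_space (DX i) \<and> sets (DX i) = sets borel"
    and DX_int: "\<forall>i<n. integrable (DX i) (\<lambda>x. x)"
    and DX_nonneg: "\<forall>i<n. AE x in DX i. 0 \<le> x"
    and c: "\<forall>i<n. 0 \<le> c i"
    and m: "\<forall>i<n. (\<integral>x. x \<partial>DX i) \<le> m"
    and y_inj: "inj_on y {..<n}" and y_pos: "\<forall>i<n. 0 < y i"
    and Sigs: "Sigs \<noteq> {}" and valid: "\<forall>s\<in>Sigs. valid_policy n {} (Sig s)"
    and meas: "realized_util 0 c (Del Sigs Sig)
                 \<in> borel_measurable (PiM {..<n} (constant_agent DX y))"
  shows "(\<integral>w. realized_util 0 c (Del Sigs Sig) w \<partial>PiM {..<n} (constant_agent DX y))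
           \<le> exp_max_net n DX c + m"
proof -
  let ?I = "{..<n}"
  let ?A = "constant_agent DX y"
  let ?U = "realized_util 0 c (Del Sigs Sig)"
  have DX_sets: "\<forall>i<n. sets (DX i) = sets borel" using DX by simp
  have law: "agent_law n DX ?A"
    using y_pos by (intro agent_law_constant_agent DX) (auto intro: less_imp_le)
  have prob: "prob_space (?A i)" if "i \<in> ?I" for i using law that by (auto simp: agent_law_def)
  interpret prob_space "PiM ?I ?A" by (intro prob_space_PiM prob)
  define Z where "Z x = (MAX i\<in>?I. max (x i - c i) 0)" for x :: "nat \<Rightarrow> real"
  \<comment> \<open>The agent's utilities equal \<open>y\<close> only almost surely, whereas the
    pointwise bound is needed everywhere. The map \<open>\<phi>\<close> resets them to
    \<open>y\<close> and fixes almost every point.\<close>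
  define \<phi> where "\<phi> w = (\<lambda>i\<in>?I. (fst (w i :: real \<times> real), y i))" for w
  define F where "F w = ?U w - Z (\<lambda>i. fst (w i)) - m" for w
  \<comment> \<open>Clipping at 0 has no effect almost surely, by \<open>DX_nonneg\<close>, and
    makes \<open>b i\<close> bounded everywhere.\<close>
  define b where "b i x = max 0 (min x (c i))" for i and x :: real
  define \<beta> where "\<beta> i = (\<integral>x. b i x \<partial>DX i)" for i
  \<comment> \<open>Outside \<open>{..<n}\<close> the restriction in \<open>\<phi>\<close> returns
    \<open>undefined\<close>, so \<open>y'\<close> is exactly the utility vector seen after
    \<open>\<phi>\<close>.\<close>
  define y' where "y' i = (if i < n then y i else snd (undefined :: real \<times> real))" for i
  define h :: "nat \<Rightarrow> (nat \<Rightarrow> real \<times> real) \<Rightarrow> real"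
    where "h i w = of_bool (selectable_unseen Sigs Sig y' i (\<lambda>j. fst (\<phi> w j)))" for i w
  define B where "B = (\<Sum>i<n. c i)"
  have b_meas: "b i \<in> borel_measurable borel" for i unfolding b_def by measurable
  have b_range: "0 \<le> b i x" "i < n \<Longrightarrow> b i x \<le> c i" for i x
    using c by (auto simp: b_def)
  have b_int: "integrable (DX i) (b i)" if "i < n" for i
  proof -
    interpret Di: prob_space "DX i" using DX that by simp
    have "b i \<in> borel_measurable (DX i)" using b_meas DX that by (simp cong: measurable_cong_sets)
    then show ?thesis
      using b_range that by (intro Di.integrable_const_bound[where B="c i"]) auto
  qed
  have \<beta>_le: "\<beta> i \<le> c i" "\<beta> i \<le> m" "0 \<le> \<beta> i" if i: "i < n" for i
  proof -
    interpret Di: prob_space "DX i" using DX i by simp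
    have "\<beta> i \<le> (\<integral>x. c i \<partial>DX i)"
      unfolding \<beta>_def using b_int b_range i by (intro integral_mono) auto
    then show "\<beta> i \<le> c i" by (simp add: Di.prob_space)
    have "\<beta> i \<le> (\<integral>x. x \<partial>DX i)"
      unfolding \<beta>_def using b_int DX_int DX_nonneg i
      by (intro integral_mono_AE) (auto simp: b_def elim!: eventually_mono)
    then show "\<beta> i \<le> m" using m i by force
    show "0 \<le> \<beta> i" unfolding \<beta>_def by (intro integral_nonneg_AE always_eventually) (simp add: b_range)
  qed
  have m_nonneg: "0 \<le> m" using \<beta>_le(2,3)[OF n] by linarith
  have \<phi>_meas: "\<phi> \<in> measurable (PiM ?I ?A) (PiM ?I ?A)"
    unfolding \<phi>_def
  proof (rule measurable_restrict)
    fix i assume i: "i \<in> ?I"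
    have "(\<lambda>w. fst (w i)) \<in> measurable (PiM ?I ?A) (DX i)"
      using agent_law_distr_component(1)[OF law DX_sets] i by simp
    from measurable_compose[OF this measurable_Pair_const_borel[of "DX i" "y i"]] DX i
    show "(\<lambda>w. (fst (w i), y i)) \<in> measurable (PiM ?I ?A) (?A i)"
      by (simp add: constant_agent_def)
  qed
  have "AE w in PiM ?I ?A. \<forall>i\<in>?I. snd (w i) = y i"
    using DX by (intro AE_finite_allI AE_PiM_component[OF prob] AE_constant_agent) auto
  then have AE_\<phi>: "AE w in PiM ?I ?A. \<phi> w = w"
    using AE_space
  proof eventually_elim
    case (elim w)
    show ?case
    proof
      fix i show "\<phi> w i = w i"
        using elim by (cases "i < n") (auto simp: \<phi>_def space_PiM PiE_def extensional_def prod_eq_iff)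
    qed
  qed
  have U_int: "integrable (PiM ?I ?A) ?U"
    by (rule integrable_realized_util_Del(1)[OF law DX_sets DX_int c Sigs valid meas])
  note Z_int = exp_max_net_eq_integral(1)[OF n law DX DX_int c, folded Z_def]
  have F_int: "integrable (PiM ?I ?A) F"
    unfolding F_def by (intro Bochner_Integration.integrable_diff U_int Z_int) simp
  have F\<phi>_meas: "(\<lambda>w. F (\<phi> w)) \<in> borel_measurable (PiM ?I ?A)"
    using measurable_compose[OF \<phi>_meas] F_int by blast
  have AE_F: "AE w in PiM ?I ?A. F (\<phi> w) = F w" using AE_\<phi> by (auto elim!: eventually_mono)
  have "(\<integral>w. F (\<phi> w) \<partial>PiM ?I ?A) \<le> 0"
  proof (rule integral_PiM_nonpos_of_le_centered
      [where a="\<lambda>i p. b i (fst p) - \<beta> i" and h=h and B=B])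
    show "integrable (PiM ?I ?A) (\<lambda>w. F (\<phi> w))"
      using F_int F\<phi>_meas AE_F by (subst integrable_cong_AE[of _ _ F]) auto
    fix i assume "i \<in> ?I"
    then have i: "i < n" by simp
    have A_borel: "sets (?A i) = sets borel" using law i by (simp add: agent_law_def)
    have bfst: "(\<lambda>p. b i (fst p)) \<in> borel_measurable (borel :: (real \<times> real) measure)"
      by (rule measurable_compose[OF _ b_meas])
         (intro borel_measurable_continuous_onI continuous_intros)
    then show "(\<lambda>p. b i (fst p) - \<beta> i) \<in> borel_measurable (?A i)"
      using A_borel by (simp cong: measurable_cong_sets)
    show "\<bar>b i (fst p) - \<beta> i\<bar> \<le> B" for p
    proof -
      have "c i \<le> B" unfolding B_def using c i by (intro member_le_sum) auto
      then show ?thesis using b_range[of i "fst p"] \<beta>_le[OF i] i by auto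
    qed
    show "(\<integral>p. b i (fst p) - \<beta> i \<partial>?A i) = 0"
    proof -
      interpret Di: prob_space "DX i" using DX i by simp
      have "(\<integral>p. b i (fst p) - \<beta> i \<partial>?A i) = (\<integral>x. b i x - \<beta> i \<partial>DX i)"
        unfolding constant_agent_def using measurable_Pair_const_borel[of "DX i" "y i"] DX i bfst
        by (subst integral_distr) auto
      also have "\<dots> = 0" using b_int[OF i] by (simp add: \<beta>_def Di.prob_space)
      finally show ?thesis .
    qed
    show "0 \<le> h i x \<and> h i x \<le> 1" for x by (simp add: h_def)
    \<comment> \<open>After \<open>\<phi>\<close> only \<open>fst v\<close> remains of
      \<open>v\<close>, so the update changes just the principal's value of \<open>i\<close>, which
      \<open>selectable_unseen\<close> ignores.\<close>
    show "h i (x(i := v)) = h i x" for x v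
    proof -
      have "(\<lambda>j. fst (\<phi> (x(i := v)) j)) = (\<lambda>j. fst (\<phi> x j))(i := fst v)"
        using i by (auto simp: \<phi>_def fun_eq_iff)
      then show ?thesis by (simp add: h_def selectable_unseen_fun_upd)
    qed
  next
    fix w assume "w \<in> space (PiM ?I ?A)"
    define x where "x = (\<lambda>i. fst (\<phi> w i))"
    have snd_\<phi>: "(\<lambda>i. snd (\<phi> w i)) = y'" by (auto simp: \<phi>_def y'_def fun_eq_iff)
    have x: "x i = fst (w i)" if "i < n" for i using that by (simp add: x_def \<phi>_def)
    have "max (x i - c i) 0 \<le> Z x" if "i < n" for i
      unfolding Z_def using that by (intro Max_ge) auto
    then have Z: "0 \<le> Z x" "\<forall>i<n. x i - c i \<le> Z x" using n by auto
    have "?U (\<phi> w) \<le> Z x + m + (\<Sum>k<n. of_bool (selectable_unseen Sigs Sig y' k x) *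
        (max 0 (min (x k) (c k)) - \<beta> k))"
    proof (rule realized_util_Del_le[OF Sigs valid])
      fix s assume "agent_optimal Sigs Sig (\<lambda>i. snd (\<phi> w i)) (\<lambda>i. fst (\<phi> w i)) s"
      then have opt: "agent_optimal Sigs Sig y' x s" by (simp add: snd_\<phi> x_def)
      have "inj_on y' ?I" "\<forall>i<n. 0 < y' i" using y_inj y_pos by (auto simp: inj_on_def y'_def)
      from principal_util_optimal_le[OF valid this opt c _ m_nonneg Z, of \<beta>] \<beta>_le
      show "principal_util c (Sig s) (\<lambda>i. fst (\<phi> w i)) \<le> Z x + m +
        (\<Sum>k<n. of_bool (selectable_unseen Sigs Sig y' k x) * (max 0 (min (x k) (c k)) - \<beta> k))"
        by (simp add: x_def)
    qed
    also have "(\<Sum>k<n. of_bool (selectable_unseen Sigs Sig y' k x) * (max 0 (min (x k) (c k)) - \<beta> k))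
        = (\<Sum>i\<in>?I. h i w * (b i (fst (w i)) - \<beta> i))"
      by (intro sum.cong) (auto simp: h_def b_def x[symmetric] x_def[symmetric])
    finally show "F (\<phi> w) \<le> (\<Sum>i\<in>?I. h i w * (b i (fst (w i)) - \<beta> i))"
      by (simp add: F_def x_def)
  qed (auto intro: prob)
  also have "(\<integral>w. F (\<phi> w) \<partial>PiM ?I ?A) = (\<integral>w. F w \<partial>PiM ?I ?A)"
    using F_int F\<phi>_meas AE_F by (intro integral_cong_AE) auto
  also have "\<dots> = (\<integral>w. ?U w \<partial>PiM ?I ?A) - exp_max_net n DX c - m"
    unfolding F_def using U_int Z_int exp_max_net_eq_integral(2)[OF n law DX DX_int c]
    by (simp add: prob_space Z_def del: realized_util.simps)
  finally show ?thesis by simp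
qed

lemma mech_value_le:
  fixes M :: "'sig mechanism"
  assumes n: "0 < n"
    and DX: "\<forall>i<n. prob_space (DX i) \<and> sets (DX i) = sets borel"
    and DX_int: "\<forall>i<n. integrable (DX i) (\<lambda>x. x)"
    and DX_nonneg: "\<forall>i<n. AE x in DX i. 0 \<le> x"
    and c: "\<forall>i<n. 0 \<le> c i"
    and m: "\<forall>i<n. (\<integral>x. x \<partial>DX i) \<le> m"
    and M: "admissible n DX c 0 M"
  shows "mech_value n DX c 0 M \<le> exp_max_net n DX c + m"
proof -
  obtain Sigs :: "'sig set" and Sig where
    Sigs: "Sigs \<noteq> {}" and valid: "\<forall>s\<in>Sigs. valid_policy n {} (Sig s)"
    and U: "realized_util 0 c M = realized_util 0 c (Del Sigs Sig)"
  proof (cases M)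
    case (NoDel p)
    show ?thesis
    proof (rule that[of "{undefined}" "\<lambda>_. p"])
      show "realized_util 0 c M = realized_util 0 c (Del {undefined} (\<lambda>_. p))"
        unfolding NoDel by (rule realized_util_NoDel_eq_Del)
    qed (use M NoDel in \<open>simp_all add: admissible_def\<close>)
  next
    case (Del Sigs Sig)
    then show ?thesis using that[of Sigs Sig] M by (simp add: admissible_def)
  qed
  have meas: "realized_util 0 c (Del Sigs Sig) \<in> borel_measurable (PiM {..<n} DXY)"
    if "agent_law n DX DXY" for DXY
    using M that U by (auto simp: admissible_def)
  \<comment> \<open>Positive and pairwise distinct; the successor keeps alternative 0 from having
    utility 0.\<close>
  define y :: "nat \<Rightarrow> real" where "y i = real (Suc i)" for i
  have law: "agent_law n DX (constant_agent DX y)"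
    by (intro agent_law_constant_agent DX) (simp add: y_def)
  \<comment> \<open>A real infimum is known to lie below its members only if the set is bounded
    below.\<close>
  have "bdd_below ((\<lambda>DXY. integral\<^sup>L (PiM {..<n} DXY) (realized_util 0 c M)) `
      {DXY. agent_law n DX DXY})"
    unfolding U
  proof (rule bdd_belowI2)
    fix DXY assume "DXY \<in> {DXY. agent_law n DX DXY}"
    then have *: "agent_law n DX DXY" by simp
    have "\<forall>i<n. sets (DX i) = sets borel" using DX by simp
    from integrable_realized_util_Del(2)[OF * this DX_int c Sigs valid meas[OF *]]
    show "- ((\<Sum>i<n. \<integral>x. \<bar>x\<bar> \<partial>DX i) + (\<Sum>i<n. c i))
            \<le> integral\<^sup>L (PiM {..<n} DXY) (realized_util 0 c (Del Sigs Sig))"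
      by linarith
  qed
  then have "mech_value n DX c 0 M
      \<le> integral\<^sup>L (PiM {..<n} (constant_agent DX y)) (realized_util 0 c M)"
    unfolding mech_value_def using law by (intro cINF_lower) auto
  also have "\<dots> \<le> exp_max_net n DX c + m"
    unfolding U
    by (rule integral_realized_util_constant_agent_le[OF n DX DX_int DX_nonneg c m _ _ Sigs valid
          meas[OF law]]) (auto simp: y_def inj_on_def)
  finally show ?thesis .
qed

text \<open>The infimum must range over a nonempty set; the agent with all utilities 0 is a
  member.\<close>

lemma mech_value_ge:
  assumes DX: "\<forall>i<n. prob_space (DX i) \<and> sets (DX i) = sets borel"
    and "\<And>DXY. agent_law n DX DXY \<Longrightarrow>
           v \<le> integral\<^sup>L (PiM {..<n} DXY) (realized_util cdel c M)"
  shows "v \<le> mech_value n DX c cdel M"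
  unfolding mech_value_def
  using agent_law_constant_agent[OF DX, of "\<lambda>_. 0"] assms(2) by (intro cINF_greatest) auto

theorem mainTheorem2:
  fixes n :: nat and DX :: "nat \<Rightarrow> real measure" and c :: "nat \<Rightarrow> real"
    and tau_star :: real and istar :: nat
  assumes n_pos: "0 < n"
    and DX_prob: "\<forall>i<n. prob_space (DX i) \<and> sets (DX i) = sets borel"
    and DX_int: "\<forall>i<n. integrable (DX i) (\<lambda>x. x)"
    and DX_nonneg: "\<forall>i<n. AE x in DX i. 0 \<le> x"
    and c_nonneg: "\<forall>i<n. 0 \<le> c i"
    and tau_star: "\<forall>DXY. agent_law n DX DXY \<longrightarrow>
        integral\<^sup>L (PiM {..<n} DXY) (realized_util 0 c (SPMI n c tau_star))
          \<ge> exp_max_net n DX c / 2"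
    and istar: "istar < n"
    and istar_argmax: "(\<integral>x. x \<partial>DX istar) = (MAX i\<in>{..<n}. \<integral>x. x \<partial>DX i)"
  shows "\<forall>M :: 'sig mechanism. admissible n DX c 0 M \<longrightarrow>
           mech_value n DX c 0 M \<le> 3 * mech_value n DX c 0
             (if (MAX i\<in>{..<n}. \<integral>x. x \<partial>DX i) \<ge> exp_max_net n DX c / 2
              then NoDel (Select istar) else SPMI n c tau_star)"
proof (intro allI impI)
  fix M :: "'sig mechanism" assume M: "admissible n DX c 0 M"
  define m where "m = (MAX i\<in>{..<n}. \<integral>x. x \<partial>DX i)"
  have "\<forall>i<n. (\<integral>x. x \<partial>DX i) \<le> m" by (auto simp: m_def)
  then have upper: "mech_value n DX c 0 M \<le> exp_max_net n DX c + m"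
    by (rule mech_value_le[OF n_pos DX_prob DX_int DX_nonneg c_nonneg _ M])
  have select: "m \<le> mech_value n DX c 0 (NoDel (Select istar) :: nat option mechanism)"
  proof (rule mech_value_ge[OF DX_prob])
    fix DXY assume law: "agent_law n DX DXY"
    have "(\<integral>w. fst (w istar) \<partial>PiM {..<n} DXY) = m"
      using agent_law_component(2)[OF law _ istar, of "\<lambda>x. x"] DX_prob istar_argmax
      by (simp add: m_def)
    moreover have "realized_util 0 c (NoDel (Select istar) :: nat option mechanism)
        = (\<lambda>w. fst (w istar))"
      by (simp add: fun_eq_iff principal_util_def)
    ultimately show "m \<le> integral\<^sup>L (PiM {..<n} DXY)
        (realized_util 0 c (NoDel (Select istar) :: nat option mechanism))"
      by simp
  qed
  have spmi: "exp_max_net n DX c / 2 \<le> mech_value n DX c 0 (SPMI n c tau_star)"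
    using tau_star by (intro mech_value_ge[OF DX_prob]) auto
  \<comment> \<open>With V for \<open>exp_max_net n DX c\<close>: if \<open>m\<close> is at least V
    / 2 then V + \<open>m\<close> is at most 3 \<open>m\<close>, and otherwise it is below 3 V /
    2.\<close>
  show "mech_value n DX c 0 M \<le> 3 * mech_value n DX c 0
      (if (MAX i\<in>{..<n}. \<integral>x. x \<partial>DX i) \<ge> exp_max_net n DX c / 2
       then NoDel (Select istar) else SPMI n c tau_star)"
    unfolding m_def[symmetric] using upper select spmi by auto
qed

end
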